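(* If $\min\{r',s'\}<\min\{r,s\}$, then every local orthogonal map $F:U\to\mathbb P^{r',s',t'}$, with $U\subset\mathbb P^{r,s,t}$ a connected open set containing a null point, is null, i.e. $F(U)$ is contained in a null space of $\mathbb P^{r',s',t'}$.
   Context: Let $r,s,t\ge 0$ be integers with $n=r+s+t>0$. $\mathbb C^{r,s,t}$ denotes $\mathbb C^n$ equipped with the Hermitian form $\langle z,w\rangle_{r,s,t}=\sum_{j=1}^{r}z_j\bar w_j-\sum_{j=r+1}^{r+s}z_j\bar w_j$, and $\mathbb P^{r,s,t}$ is its projectivization. A point $[z]$ is null if $\langle z,z\rangle_{r,s,t}=0$; $[z]\perp[w]$ if $\langle z,w\rangle_{r,s,t}=0$. A projective linear subspace $\mathbb PH$ is a null space if the form vanishes identically on $H$. A holomorphic map $F:U\to\mathbb P^{r',s',t'}$ on a connected open set $U\subset\mathbb P^{r,s,t}$ containing a null point is a local orthogonal map if $F(p)\perp F(q)$ for all $p,q\in U$ with $p\perp q$. *)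

theory Defs
  imports "HOL-Analysis.Analysis"
begin

text \<open>Vectors of C^n are modelled as complex^'n for a finite index type 'n (so n = CARD('n) > 0).
  The signature (r,s,t) is encoded by two disjoint index sets: Pos (r = card Pos, the indices with
  coefficient +1), Neg (s = card Neg, coefficient -1), and the remaining indices (t of them,
  coefficient 0).\<close>

definition herm_form :: "'n::finite set \<Rightarrow> 'n set \<Rightarrow> complex^'n \<Rightarrow> complex^'n \<Rightarrow> complex" where
  "herm_form Pos Neg z w = (\<Sum>j\<in>Pos. z$j * cnj (w$j)) - (\<Sum>j\<in>Neg. z$j * cnj (w$j))"

definition proj :: "complex^'n \<Rightarrow> (complex^'n) set" where
  "proj z = {c *s z | c. c \<noteq> 0}"

definition Pspace :: "(complex^'n) set set" where
  "Pspace = {proj z | z. z \<noteq> 0}"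

lemma proj_eq_if_meet:
  assumes "x \<in> proj z" "x \<in> proj w" "z \<noteq> 0"
  shows "proj z = proj w"
proof -
  obtain a where a: "a \<noteq> 0" "x = a *s z" using assms(1) unfolding proj_def by auto
  obtain b where b: "b \<noteq> 0" "x = b *s w" using assms(2) unfolding proj_def by auto
  have zw: "z = (b / a) *s w" using a b by (metis (no_types, lifting) divide_inverse_commute
        left_inverse mult.commute vector_smult_assoc vector_smult_lid)
  show ?thesis
  proof (intro set_eqI iffI)
    fix y assume "y \<in> proj z"
    then obtain c where "c \<noteq> 0" "y = c *s z" unfolding proj_def by auto
    then have "y = (c * (b / a)) *s w" "c * (b/a) \<noteq> 0" using zw a b by (auto simp: vector_smult_assoc)
    then show "y \<in> proj w" unfolding proj_def by blast
  next
    fix y assume "y \<in> proj w"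
    then obtain c where "c \<noteq> 0" "y = c *s w" unfolding proj_def by auto
    moreover have "w = (a / b) *s z" using a b by (metis (no_types, lifting) divide_inverse_commute
        left_inverse mult.commute vector_smult_assoc vector_smult_lid)
    ultimately have "y = (c * (a / b)) *s z" "c * (a/b) \<noteq> 0" using a b by (auto simp: vector_smult_assoc)
    then show "y \<in> proj z" unfolding proj_def by blast
  qed
qed

text \<open>Quotient topology on projective space: a set of points is open iff the union of the
  corresponding punctured lines is open in C^n.\<close>
definition proj_open :: "(complex^'n) set set \<Rightarrow> bool" where
  "proj_open U \<longleftrightarrow> U \<subseteq> Pspace \<and> open (\<Union>U)"

lemma istopology_proj_open: "istopology (proj_open :: (complex^'n::finite) set set \<Rightarrow> bool)"
  unfolding istopology_def
proof (intro conjI allI impI)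
  fix S T :: "(complex^'n) set set" assume h1: "proj_open S" and h2: "proj_open T"
  have h: "proj_open S \<and> proj_open T" using h1 h2 by blast
  have "\<Union>(S \<inter> T) = \<Union>S \<inter> \<Union>T"
  proof (intro set_eqI iffI)
    fix x assume "x \<in> \<Union>S \<inter> \<Union>T"
    then obtain A B where AB: "x \<in> A" "A \<in> S" "x \<in> B" "B \<in> T" by auto
    obtain z where z: "A = proj z" "z \<noteq> 0" using AB h unfolding proj_open_def Pspace_def by auto
    obtain w where w: "B = proj w" using AB h unfolding proj_open_def Pspace_def by auto
    have "A = B" using proj_eq_if_meet[of x z w] AB z w by simp
    then show "x \<in> \<Union>(S \<inter> T)" using AB by auto
  qed auto
  moreover have "open (\<Union>S \<inter> \<Union>T)" using h unfolding proj_open_def by (intro open_Int) auto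
  ultimately have "open (\<Union>(S \<inter> T))" by simp
  moreover have "S \<inter> T \<subseteq> Pspace" using h unfolding proj_open_def by blast
  ultimately show "proj_open (S \<inter> T)" unfolding proj_open_def by blast
next
  fix K :: "(complex^'n) set set set" assume "\<forall>S\<in>K. proj_open S"
  then have h: "\<forall>S\<in>K. S \<subseteq> Pspace \<and> open (\<Union>S)" unfolding proj_open_def by blast
  have "\<Union>(\<Union>K) = \<Union>(Union ` K)" by auto
  moreover have "open (\<Union>(Union ` K))" using h by (intro open_Union) auto
  ultimately show "proj_open (\<Union>K)" using h unfolding proj_open_def by auto
qed

definition proj_top :: "(complex^'n) set topology" where
  "proj_top = topology proj_open"

definition null_point :: "'n::finite set \<Rightarrow> 'n set \<Rightarrow> (complex^'n) set \<Rightarrow> bool" where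
  "null_point Pos Neg p \<longleftrightarrow> (\<forall>z\<in>p. herm_form Pos Neg z z = 0)"

definition proj_orth :: "'n::finite set \<Rightarrow> 'n set \<Rightarrow> (complex^'n) set \<Rightarrow> (complex^'n) set \<Rightarrow> bool" where
  "proj_orth Pos Neg p q \<longleftrightarrow> (\<forall>z\<in>p. \<forall>w\<in>q. herm_form Pos Neg z w = 0)"

definition complex_subspace :: "(complex^'n) set \<Rightarrow> bool" where
  "complex_subspace H \<longleftrightarrow> 0 \<in> H \<and> (\<forall>x\<in>H. \<forall>y\<in>H. x + y \<in> H) \<and> (\<forall>c. \<forall>x\<in>H. c *s x \<in> H)"

text \<open>The projectivization of H, P H, consists of the points p with p \<subseteq> H.\<close>
definition null_space :: "'n::finite set \<Rightarrow> 'n set \<Rightarrow> (complex^'n) set \<Rightarrow> bool" where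
  "null_space Pos Neg H \<longleftrightarrow> complex_subspace H \<and> (\<forall>z\<in>H. \<forall>w\<in>H. herm_form Pos Neg z w = 0)"

definition holo_vec :: "(complex^'n \<Rightarrow> complex^'m) \<Rightarrow> (complex^'n) set \<Rightarrow> bool" where
  "holo_vec f W \<longleftrightarrow> (\<forall>x\<in>W. \<exists>D. (f has_derivative D) (at x) \<and> (\<forall>c v. D (c *s v) = c *s D v))"

definition proj_holomorphic :: "((complex^'n) set \<Rightarrow> (complex^'m) set) \<Rightarrow> (complex^'n) set set \<Rightarrow> bool" where
  "proj_holomorphic F U \<longleftrightarrow> F ` U \<subseteq> Pspace \<and>
     (\<forall>z. z \<noteq> 0 \<and> proj z \<in> U \<longrightarrow>
        (\<exists>W f. open W \<and> z \<in> W \<and> W \<subseteq> \<Union>U \<and> holo_vec f W \<and>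
               (\<forall>w\<in>W. f w \<noteq> 0 \<and> F (proj w) = proj (f w))))"

definition local_orthogonal_map ::
  "'n::finite set \<Rightarrow> 'n set \<Rightarrow> 'm::finite set \<Rightarrow> 'm set \<Rightarrow>
   ((complex^'n) set \<Rightarrow> (complex^'m) set) \<Rightarrow> (complex^'n) set set \<Rightarrow> bool" where
  "local_orthogonal_map Pos Neg Pos' Neg' F U \<longleftrightarrow>
     openin proj_top U \<and> connectedin proj_top U \<and> (\<exists>p\<in>U. null_point Pos Neg p) \<and>
     proj_holomorphic F U \<and>
     (\<forall>p\<in>U. \<forall>q\<in>U. proj_orth Pos Neg p q \<longrightarrow> proj_orth Pos' Neg' (F p) (F q))"

definition null_map ::
  "'m::finite set \<Rightarrow> 'm set \<Rightarrow> ((complex^'n) set \<Rightarrow> (complex^'m) set) \<Rightarrow> (complex^'n) set set \<Rightarrow> bool" where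
  "null_map Pos' Neg' F U \<longleftrightarrow> (\<exists>H. null_space Pos' Neg' H \<and> (\<forall>p\<in>U. F p \<subseteq> H))"

end

(* Let f be a lift of F on a convex open set W. An isotropic subspace of the target has dimension at
   most min r' s' modulo the radical. Choose pairwise orthogonal null points p_1, ..., p_k of W with
   f p_1, ..., f p_k linearly independent modulo the radical and k maximal; then k < min r s, so the
   form still takes both signs on V = {p_1, ..., p_k}^perp. A null point q of V cannot prolong the
   family, so f q lies in the span of the f p_i modulo the radical and is orthogonal to f z for all z
   in V. Since null points are a uniqueness set for holomorphic functions on V, f (V \<inter> W) is isotropic.
   Independence is an open condition and the p_i can be rotated with V, so the form vanishes at
   (f z, f z) for all z in an open set; polarization and analytic continuation do the rest. *)
theory Submission
  imports Defs "HOL-Complex_Analysis.Conformal_Mappings"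
begin

section \<open>Hermitian forms\<close>

lemma herm_form_add_left:
  "herm_form P N (x + y) w = herm_form P N x w + herm_form P N y w"
  by (simp add: herm_form_def sum.distrib algebra_simps)

lemma herm_form_add_right:
  "herm_form P N z (x + y) = herm_form P N z x + herm_form P N z y"
  by (simp add: herm_form_def sum.distrib algebra_simps)

lemma herm_form_scale_left: "herm_form P N (c *s z) w = c * herm_form P N z w"
  by (simp add: herm_form_def sum_distrib_left algebra_simps)

lemma herm_form_scale_right: "herm_form P N z (c *s w) = cnj c * herm_form P N z w"
  by (simp add: herm_form_def sum_distrib_left algebra_simps)

lemma herm_form_diff_left:
  "herm_form P N (x - y) w = herm_form P N x w - herm_form P N y w"
  by (simp add: herm_form_def sum_subtractf algebra_simps)

lemma herm_form_diff_right:
  "herm_form P N z (x - y) = herm_form P N z x - herm_form P N z y"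
  by (simp add: herm_form_def sum_subtractf algebra_simps)

lemma herm_form_sum_left:
  "herm_form P N (\<Sum>i\<in>I. c i *s x i) w = (\<Sum>i\<in>I. c i * herm_form P N (x i) w)"
  by (induction I rule: infinite_finite_induct)
     (simp_all add: herm_form_add_left herm_form_scale_left, simp_all add: herm_form_def)

lemmas herm_form_linear =
  herm_form_add_left herm_form_add_right herm_form_scale_left herm_form_scale_right
  herm_form_diff_left herm_form_diff_right

lemma cnj_herm_form: "cnj (herm_form P N z w) = herm_form P N w z"
  by (simp add: herm_form_def mult.commute)

lemma herm_form_zero_commute: "herm_form P N z w = 0 \<longleftrightarrow> herm_form P N w z = 0"
  by (metis cnj_herm_form complex_cnj_zero_iff)

lemma herm_form_self_real: "herm_form P N z z = of_real (Re (herm_form P N z z))"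
  by (metis Reals_cnj_iff cnj_herm_form of_real_Re)

lemma herm_form_swap: "herm_form N P z w = - herm_form P N z w"
  by (simp add: herm_form_def)

text \<open>For fixed \<open>w\<close> this exhibits the form as a linear functional of
  \<open>z\<close> in coordinates, so that statements about linear combinations of coordinates apply
  to it.\<close>

lemma herm_form_eq_sum_UNIV:
  "herm_form P N z w =
    (\<Sum>j\<in>UNIV. ((if j \<in> P then cnj (w $ j) else 0) - (if j \<in> N then cnj (w $ j) else 0)) * z $ j)"
proof -
  have "(\<Sum>j\<in>Q. z $ j * cnj (w $ j)) = (\<Sum>j\<in>UNIV. if j \<in> Q then z $ j * cnj (w $ j) else 0)" for Q
    by (simp add: sum.If_cases)
  then show ?thesis
    unfolding herm_form_def sum_subtractf[symmetric] by (auto simp flip: sum_subtractf intro!: sum.cong)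
qed

lemma continuous_on_herm_form [continuous_intros]:
  assumes "continuous_on S f" "continuous_on S g"
  shows "continuous_on S (\<lambda>x. herm_form P N (f x) (g x))"
  unfolding herm_form_def using assms by (intro continuous_intros)

lemma tendsto_herm_form [tendsto_intros]:
  assumes "(f \<longlongrightarrow> a) F" "(g \<longlongrightarrow> b) F"
  shows "((\<lambda>x. herm_form P N (f x) (g x)) \<longlongrightarrow> herm_form P N a b) F"
  unfolding herm_form_def using assms by (intro tendsto_intros)

lemma herm_form_self_Re:
  "Re (herm_form P N z z) = (\<Sum>j\<in>P. (cmod (z $ j))\<^sup>2) - (\<Sum>j\<in>N. (cmod (z $ j))\<^sup>2)"
  by (simp add: herm_form_def complex_mult_cnj cmod_power2)

lemma tendsto_vector_smult [tendsto_intros]: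
  fixes f :: "'b \<Rightarrow> 'a::real_normed_algebra"
  assumes "(f \<longlongrightarrow> c) F" "(g \<longlongrightarrow> x) F"
  shows "((\<lambda>t. f t *s g t) \<longlongrightarrow> c *s x) F"
  by (rule vec_tendstoI) (auto intro!: tendsto_intros assms)

lemma continuous_on_vector_smult [continuous_intros]:
  fixes f :: "'b::topological_space \<Rightarrow> 'a::real_normed_algebra"
  assumes "continuous_on S f" "continuous_on S g"
  shows "continuous_on S (\<lambda>t. f t *s g t)"
  using assms unfolding continuous_on_def by (auto intro: tendsto_vector_smult)

lemma tendsto_det [tendsto_intros]:
  fixes M :: "'b \<Rightarrow> 'a::real_normed_field^'n^'n"
  assumes "(M \<longlongrightarrow> A) F"
  shows "((\<lambda>t. det (M t)) \<longlongrightarrow> det A) F"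
  unfolding det_def using assms by (intro tendsto_intros) auto

section \<open>Linear algebra\<close>

text \<open>A square matrix encodes the system: each row outside \<open>P\<close> forces its
  coordinate to vanish, and the equations occupy distinct rows in \<open>P\<close>. There are fewer
  equations than indices in \<open>P\<close>, so some row stays zero and the singular matrix has a
  kernel vector.\<close>

lemma homogeneous_system_nontrivial_solution:
  fixes A :: "('a::field^'n) set"
  assumes "finite A" "card A < card P"
  obtains x where "x \<noteq> 0" "\<And>i. i \<notin> P \<Longrightarrow> x $ i = 0" "\<And>a. a \<in> A \<Longrightarrow> (\<Sum>i\<in>P. a $ i * x $ i) = 0"
proof -
  obtain g where g: "g ` A \<subseteq> P" "inj_on g A"
    using card_le_inj[of A P] assms by auto
  define M :: "'a^'n^'n" where
    "M = (\<chi> i. if i \<notin> P then axis i 1 else if i \<in> g ` A then (\<chi> j. if j \<in> P then inv_into A g i $ j else 0) else 0)"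
  have "g ` A \<noteq> P"
    using assms g card_image by fastforce
  then obtain k where k: "k \<in> P" "k \<notin> g ` A" using g by auto
  have "row k M = 0"
    using k by (auto simp: M_def row_def vec_eq_iff)
  then have "det M = 0" by (rule det_zero_row(2))
  then have "\<not> (\<exists>B. B ** M = mat 1)"
    by (meson invertible_det_nz invertible_left_inverse)
  then obtain x where x: "M *v x = 0" "x \<noteq> 0"
    using matrix_left_invertible_ker by blast
  show thesis
  proof
    show "x \<noteq> 0" by fact
  next
    fix i assume "i \<notin> P"
    then have "M $ i $ j * x $ j = (if j = i then x $ j else 0)" for j
      by (simp add: M_def axis_def)
    then have "(M *v x) $ i = x $ i"
      by (simp add: matrix_vector_mult_def)
    with x show "x $ i = 0" by simp
  next
    fix a assume "a \<in> A"
    then have "(M *v x) $ (g a) = (\<Sum>i\<in>UNIV. if i \<in> P then a $ i * x $ i else 0)"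
      using g unfolding matrix_vector_mult_def by (auto simp: M_def inv_into_f_f intro!: sum.cong)
    also have "\<dots> = (\<Sum>i\<in>P. a $ i * x $ i)" by (simp add: sum.If_cases)
    finally have "(M *v x) $ (g a) = (\<Sum>i\<in>P. a $ i * x $ i)" .
    with x show "(\<Sum>i\<in>P. a $ i * x $ i) = 0" by simp
  qed
qed

text \<open>Fewer than \<open>card P\<close> linear conditions leave a nonzero vector supported on
  \<open>P\<close>, where the form is positive definite because \<open>N\<close> is disjoint from
  \<open>P\<close>.\<close>

lemma ex_definite_vector_orthogonal:
  fixes A :: "(complex^'n) set"
  assumes "P \<inter> N = {}" "finite A" "card A < card P"
  obtains x where "Re (herm_form P N x x) > 0" "\<And>a. a \<in> A \<Longrightarrow> herm_form P N x a = 0"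
proof -
  \<comment> \<open>The unknown stands in the first argument of the form, so the vectors of
    \<open>A\<close> enter the system conjugated.\<close>
  define B where "B = (\<lambda>a. \<chi> i. cnj (a $ i)) ` A"
  have "finite B" "card B < card P"
    unfolding B_def using assms card_image_le[of A] by (auto intro: le_less_trans)
  then obtain x where x: "x \<noteq> 0" "\<And>i. i \<notin> P \<Longrightarrow> x $ i = 0" "\<And>b. b \<in> B \<Longrightarrow> (\<Sum>i\<in>P. b $ i * x $ i) = 0"
    using homogeneous_system_nontrivial_solution by blast
  have N: "x $ j = 0" if "j \<in> N" for j using x(2) that assms(1) by blast
  show thesis
  proof
    obtain i where "x $ i \<noteq> 0" using x(1) by (auto simp: vec_eq_iff)
    moreover from this have "i \<in> P" using x(2) by blast
    ultimately have "(\<Sum>j\<in>P. (cmod (x $ j))\<^sup>2) > 0"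
      by (intro sum_pos2[of _ i]) auto
    then show "Re (herm_form P N x x) > 0"
      using N by (simp add: herm_form_self_Re)
    show "herm_form P N x a = 0" if "a \<in> A" for a
      using x(3)[of "\<chi> i. cnj (a $ i)"] that N by (simp add: herm_form_def B_def mult.commute)
  qed
qed

text \<open>Along \<open>p + t a\<close> the form consists of a linear term in \<open>t\<close> and
  a positive quadratic one; a suitable sign of \<open>t\<close> makes the linear term
  nonnegative.\<close>

lemma herm_form_sign_near:
  fixes W :: "(complex^'n) set"
  assumes W: "open W" "p \<in> W" "herm_form P N p p = 0"
    and a: "Re (herm_form P N a a) > 0" 
  obtains t :: real where "p + of_real t *s a \<in> W" "Re (herm_form P N (p + of_real t *s a) (p + of_real t *s a)) > 0"
proof -
  define s :: real where "s = (if Re (herm_form P N p a) \<ge> 0 then 1 else -1)"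
  have "((\<lambda>t::real. p + of_real (s * t) *s a) \<longlongrightarrow> p + of_real (s * 0) *s a) (at_right 0)"
    by (intro tendsto_intros) 
  then have "eventually (\<lambda>t::real. p + of_real (s * t) *s a \<in> W) (at_right 0)"
    using W by (auto dest: topological_tendstoD)
  moreover have "eventually (\<lambda>t::real. t > 0) (at_right 0)"
    by (rule eventually_at_right_less)
  ultimately obtain t :: real where t: "t > 0" "p + of_real (s * t) *s a \<in> W"
    using eventually_happens[OF eventually_conj] trivial_limit_at_right_real by blast
  have r: "Re (herm_form P N a p) = Re (herm_form P N p a)"
    by (metis cnj_herm_form complex_cnj cnj.sel(1))
  have "Re (herm_form P N (p + of_real (s * t) *s a) (p + of_real (s * t) *s a))
      = 2 * t * (s * Re (herm_form P N p a)) + t\<^sup>2 * Re (herm_form P N a a)"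
    using W(3) r by (simp add: herm_form_linear s_def power2_eq_square algebra_simps)
  also have "\<dots> > 0"
  proof -
    have "s * Re (herm_form P N p a) \<ge> 0" by (auto simp: s_def)
    then have "2 * t * (s * Re (herm_form P N p a)) \<ge> 0" using t(1) by simp
    moreover have "t\<^sup>2 * Re (herm_form P N a a) > 0" using t(1) a by simp
    ultimately show ?thesis by linarith
  qed
  finally show thesis using that t(2) by blast
qed

section \<open>Holomorphy along complex lines\<close>

text \<open>Holomorphy in one variable along each complex line suffices for continuation over a
  convex set: any two of its points lie on a complex line that meets the set in a connected
  set.\<close>

definition holo_on_lines :: "(complex^'n \<Rightarrow> complex) \<Rightarrow> (complex^'n) set \<Rightarrow> bool" where
  "holo_on_lines g W \<longleftrightarrow> (\<forall>a d. (\<lambda>\<zeta>. g (a + \<zeta> *s d)) holomorphic_on {\<zeta>. a + \<zeta> *s d \<in> W})"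

lemma open_line_preimage:
  fixes W :: "(complex^'n) set"
  assumes "open W"
  shows "open {\<zeta>. a + \<zeta> *s d \<in> W}"
proof -
  have "continuous_on UNIV (\<lambda>\<zeta>. a + \<zeta> *s d)"
    by (intro continuous_intros)
  then have "open ((\<lambda>\<zeta>. a + \<zeta> *s d) -` W)"
    using assms by (auto intro: open_vimage)
  then show ?thesis by (simp add: vimage_def)
qed

lemma convex_line_preimage:
  fixes W :: "(complex^'n) set"
  assumes "convex W"
  shows "convex {\<zeta>. a + \<zeta> *s d \<in> W}"
proof (rule convexI)
  fix x y :: complex and u v :: real
  assume h: "x \<in> {\<zeta>. a + \<zeta> *s d \<in> W}" "y \<in> {\<zeta>. a + \<zeta> *s d \<in> W}" "0 \<le> u" "0 \<le> v" "u + v = 1"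
  have v: "v = 1 - u" using h(5) by simp
  have "a + (u *\<^sub>R x + v *\<^sub>R y) *s d = u *\<^sub>R (a + x *s d) + v *\<^sub>R (a + y *s d)"
    by (simp add: v vec_eq_iff scaleR_conv_of_real[where 'a = complex] algebra_simps)
  moreover have "u *\<^sub>R (a + x *s d) + v *\<^sub>R (a + y *s d) \<in> W"
    using assms h by (intro convexD) auto
  ultimately show "u *\<^sub>R x + v *\<^sub>R y \<in> {\<zeta>. a + \<zeta> *s d \<in> W}" by simp
qed

text \<open>By the chain rule the derivative is \<open>c \<mapsto> D (c *s d)\<close>, and complex
  linearity of \<open>D\<close> turns it into multiplication by a complex number.\<close>

lemma holo_vec_component_on_line:
  assumes "holo_vec f W"
  shows "(\<lambda>\<zeta>. f (a + \<zeta> *s d) $ j) holomorphic_on {\<zeta>. a + \<zeta> *s d \<in> W}"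
  unfolding holomorphic_on_def
proof
  fix \<zeta> assume "\<zeta> \<in> {\<zeta>. a + \<zeta> *s d \<in> W}"
  then obtain D where D: "(f has_derivative D) (at (a + \<zeta> *s d))" "\<And>c v. D (c *s v) = c *s D v"
    using assms unfolding holo_vec_def by blast
  have "bounded_linear (\<lambda>c::complex. c *s d)"
    by (intro linear_conv_bounded_linear[THEN iffD1] linearI)
       (simp_all add: vec_eq_iff algebra_simps)
  then have "((\<lambda>\<zeta>. a + \<zeta> *s d) has_derivative (\<lambda>c. 0 + c *s d)) (at \<zeta>)"
    by (intro has_derivative_add has_derivative_const bounded_linear_imp_has_derivative)
  from has_derivative_compose[OF this D(1)]
  have "((\<lambda>\<zeta>. f (a + \<zeta> *s d)) has_derivative (\<lambda>c. c *s D d)) (at \<zeta>)"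
    by (simp add: D(2))
  from bounded_linear.has_derivative[OF bounded_linear_vec_nth this, of j]
  have "((\<lambda>\<zeta>. f (a + \<zeta> *s d) $ j) has_derivative (*) (D d $ j)) (at \<zeta>)"
    by (simp add: mult.commute[of _ "D d $ j"])
  then have "((\<lambda>\<zeta>. f (a + \<zeta> *s d) $ j) has_field_derivative D d $ j) (at \<zeta>)"
    by (simp add: has_field_derivative_def)
  then show "(\<lambda>\<zeta>. f (a + \<zeta> *s d) $ j) field_differentiable at \<zeta> within {\<zeta>. a + \<zeta> *s d \<in> W}"
    using field_differentiable_def has_field_derivative_at_within by blast
qed

lemma holo_vec_linear_combination:
  assumes "holo_vec f W"
  shows "holo_on_lines (\<lambda>w. \<Sum>j\<in>UNIV. c j * f w $ j) W"
  unfolding holo_on_lines_def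
  by (intro allI holomorphic_on_sum holomorphic_on_mult holomorphic_on_const
        holo_vec_component_on_line[OF assms])

lemma holo_vec_herm_form:
  assumes "holo_vec f W"
  shows "holo_on_lines (\<lambda>w. herm_form P N (f w) y) W"
  unfolding herm_form_eq_sum_UNIV by (rule holo_vec_linear_combination[OF assms])

text \<open>The complex line through \<open>x\<close> and \<open>w\<close> meets \<open>W\<close> in
  a convex, hence connected, set and \<open>X\<close> in a nonempty open one, so the identity
  theorem in one variable applies.\<close>

lemma holo_on_lines_zero_of_open:
  assumes g: "holo_on_lines g W" and W: "open W" "convex W"
    and X: "open X" "x \<in> X" "X \<subseteq> W" "\<And>w. w \<in> X \<Longrightarrow> g w = 0" and "w \<in> W"
  shows "g w = 0"
proof -
  define L where "L = (\<lambda>\<zeta>. x + \<zeta> *s (w - x))"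
  have "g (L 1) = 0"
  proof (rule analytic_continuation_open[of "{\<zeta>. L \<zeta> \<in> X}" "{\<zeta>. L \<zeta> \<in> W}" "\<lambda>\<zeta>. g (L \<zeta>)" "\<lambda>_. 0"])
    show "open {\<zeta>. L \<zeta> \<in> X}" "open {\<zeta>. L \<zeta> \<in> W}"
      unfolding L_def by (intro open_line_preimage X W)+
    show "connected {\<zeta>. L \<zeta> \<in> W}"
      unfolding L_def by (intro convex_connected convex_line_preimage W)
    show "(\<lambda>\<zeta>. g (L \<zeta>)) holomorphic_on {\<zeta>. L \<zeta> \<in> W}"
      unfolding L_def by (rule g[unfolded holo_on_lines_def, rule_format])
    have "L 0 \<in> X" using X by (simp add: L_def)
    then show "{\<zeta>. L \<zeta> \<in> X} \<noteq> {}" by blast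
    show "1 \<in> {\<zeta>. L \<zeta> \<in> W}" using assms(8) by (simp add: L_def)
  qed (use X in auto)
  then show ?thesis by (simp add: L_def)
qed

text \<open>On the complex line through a positive and a negative vector, the null vectors separate
  these two points, so there are uncountably many of them: more than a nonzero holomorphic
  function can vanish on.\<close>

lemma holo_on_lines_zero_of_null_pair:
  assumes g: "holo_on_lines g W" and W: "open W" "convex W" and V: "complex_subspace V"
    and null: "\<And>q. q \<in> V \<inter> W \<Longrightarrow> herm_form P N q q = 0 \<Longrightarrow> g q = 0"
    and x: "x \<in> V \<inter> W" "Re (herm_form P N x x) > 0"
    and y: "y \<in> V \<inter> W" "Re (herm_form P N y y) < 0"
  shows "g x = 0" "g y = 0"
proof -
  define L where "L = (\<lambda>\<zeta>. x + \<zeta> *s (y - x))"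
  define D where "D = {\<zeta>. L \<zeta> \<in> W}"
  define E where "E = {\<zeta> \<in> D. herm_form P N (L \<zeta>) (L \<zeta>) = 0}"
  have D: "open D" "connected D"
    unfolding D_def L_def by (intro open_line_preimage convex_connected convex_line_preimage W)+
  have D01: "0 \<in> D" "1 \<in> D" using x y by (auto simp: D_def L_def)
  have "L \<zeta> = (1 - \<zeta>) *s x + \<zeta> *s y" for \<zeta>
    by (simp add: L_def vec_eq_iff algebra_simps)
  then have LV: "L \<zeta> \<in> V" for \<zeta>
    using V x(1) y(1) unfolding complex_subspace_def by (metis Int_iff)
  \<comment> \<open>Removing a countable set keeps an open connected subset of the plane connected;
    the form would then change sign on \<open>D - E\<close> without a zero there.\<close>
  have "uncountable E"
  proof
    assume "countable E"
    then have "connected (D - E)"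
      using D by (intro connected_open_diff_countable) auto
    moreover have "continuous_on (D - E) (\<lambda>\<zeta>. Re (herm_form P N (L \<zeta>) (L \<zeta>)))"
      unfolding L_def by (intro continuous_intros)
    ultimately have "connected ((\<lambda>\<zeta>. Re (herm_form P N (L \<zeta>) (L \<zeta>))) ` (D - E))"
      by (rule connected_continuous_image[rotated])
    moreover have "0 \<in> D - E" "1 \<in> D - E"
      using D01 x(2) y(2) by (auto simp: E_def L_def)
    then have "Re (herm_form P N x x) \<in> (\<lambda>\<zeta>. Re (herm_form P N (L \<zeta>) (L \<zeta>))) ` (D - E)"
      "Re (herm_form P N y y) \<in> (\<lambda>\<zeta>. Re (herm_form P N (L \<zeta>) (L \<zeta>))) ` (D - E)"
      by (auto simp: L_def intro: rev_image_eqI)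
    ultimately have "0 \<in> (\<lambda>\<zeta>. Re (herm_form P N (L \<zeta>) (L \<zeta>))) ` (D - E)"
      using x(2) y(2) unfolding connected_iff_interval by (meson less_imp_le)
    then obtain \<zeta> where "\<zeta> \<in> D - E" "Re (herm_form P N (L \<zeta>) (L \<zeta>)) = 0" by auto
    then show False
      using herm_form_self_real[of P N "L \<zeta>"] by (simp add: E_def)
  qed
  moreover have "E \<subseteq> {\<zeta> \<in> D. g (L \<zeta>) = 0}"
    using null LV by (auto simp: E_def D_def)
  ultimately have "uncountable {\<zeta> \<in> D. g (L \<zeta>) = 0}"
    using countable_subset by blast
  moreover have "(\<lambda>\<zeta>. g (L \<zeta>)) holomorphic_on D"
    unfolding L_def D_def by (rule g[unfolded holo_on_lines_def, rule_format])
  \<comment> \<open>As \<open>D\<close> is a countable union of compact sets, one of them contains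
    infinitely many of the uncountably many zeros, which therefore accumulate in
    \<open>D\<close>.\<close>
  moreover have "fsigma D"
  proof (rule open_Union_compact_subsets[OF D(1)])
    fix C :: "nat \<Rightarrow> complex set"
    assume C: "\<And>n. compact (C n)" "\<Union> (range C) = D"
    have "fsigma (\<Union> (range C))"
      by (rule fsigma.intros) (rule compact_imp_closed[OF C(1)])
    then show "fsigma D" unfolding C(2) .
  qed
  ultimately have "D \<subseteq> {\<zeta> \<in> D. g (L \<zeta>) = 0}"
    using D by (intro holomorphic_countable_equal) auto
  then have "g (L 0) = 0" "g (L 1) = 0" using D01 by auto
  then show "g x = 0" "g y = 0" by (simp_all add: L_def)
qed

text \<open>A positive \<open>z\<close> can be paired with \<open>y\<close>, a negative one with
  \<open>x\<close>, and a null \<open>z\<close> is covered by the hypothesis.\<close>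

lemma holo_on_lines_zero_of_null:
  assumes g: "holo_on_lines g W" and W: "open W" "convex W" and V: "complex_subspace V"
    and null: "\<And>q. q \<in> V \<inter> W \<Longrightarrow> herm_form P N q q = 0 \<Longrightarrow> g q = 0"
    and x: "x \<in> V \<inter> W" "Re (herm_form P N x x) > 0"
    and y: "y \<in> V \<inter> W" "Re (herm_form P N y y) < 0"
    and z: "z \<in> V \<inter> W"
  shows "g z = 0"
proof -
  consider "Re (herm_form P N z z) > 0" | "Re (herm_form P N z z) < 0" | "herm_form P N z z = 0"
    using herm_form_self_real[of P N z] by (metis linorder_neqE_linordered_idom of_real_0)
  then show ?thesis
    using holo_on_lines_zero_of_null_pair[OF g W V null] x y z null by cases blast+
qed

section \<open>Polarization\<close>

text \<open>The reals accumulate at 0. This serves to extend an identity from real to complex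
  parameters, one variable at a time.\<close>

lemma holomorphic_zero_of_real_zero:
  assumes "F holomorphic_on ball 0 1" "\<And>t::real. \<bar>t\<bar> < 1 \<Longrightarrow> F (of_real t) = 0" "x \<in> ball 0 1"
  shows "F x = 0"
proof (rule analytic_continuation[of F "ball 0 1" "of_real ` {-1<..<1::real}" 0])
  show "0 islimpt (of_real ` {-1<..<1::real} :: complex set)"
    unfolding islimpt_approachable
  proof (intro allI impI)
    fix e :: real assume "e > 0"
    then show "\<exists>x'\<in>of_real ` {-1<..<1::real}. x' \<noteq> (0::complex) \<and> dist x' 0 < e"
      by (intro bexI[of _ "of_real (min (e/2) (1/2))"]) (auto simp: min_def)
  qed
qed (use assms in auto)

text \<open>The argument and its conjugate are made independent: with
  \<open>\<zeta> = x + \<i> * y\<close>, the diagonal values extend to a function \<open>H\<close>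
  of two complex variables that vanishes for real \<open>x\<close> and \<open>y\<close>, hence,
  extending first in \<open>x\<close> and then in \<open>y\<close>, for complex ones.\<close>

lemma herm_form_polarization_disc:
  fixes K :: "complex \<Rightarrow> complex^'m"
  assumes hol: "\<And>j. (\<lambda>\<zeta>. K \<zeta> $ j) holomorphic_on ball 0 2"
    and diag: "\<And>\<zeta>. \<zeta> \<in> ball 0 2 \<Longrightarrow> herm_form P N (K \<zeta>) (K \<zeta>) = 0"
  shows "herm_form P N (K 0) (K 1) = 0"
proof -
  \<comment> \<open>The reflected function is holomorphic, and at \<open>s - \<i> * t\<close> with
    \<open>s\<close>, \<open>t\<close> real it is the conjugate of the value of \<open>K\<close> at
    \<open>s + \<i> * t\<close>.\<close>
  define L where "L = (\<lambda>j \<zeta>. cnj (K (cnj \<zeta>) $ j))"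
  have L: "L j holomorphic_on ball 0 2" for j
  proof -
    have "cnj ` ball 0 2 = ball 0 2"
      by (auto simp: image_iff intro!: bexI[of _ "cnj _"])
    then have "cnj \<circ> (\<lambda>\<zeta>. K \<zeta> $ j) \<circ> cnj holomorphic_on ball 0 2"
      using hol[of j] by (intro holomorphic_on_compose_cnj_cnj) auto
    then show ?thesis by (simp add: L_def o_def)
  qed
  define H where "H = (\<lambda>x y. (\<Sum>j\<in>P. K (x + \<i> * y) $ j * L j (x - \<i> * y))
     - (\<Sum>j\<in>N. K (x + \<i> * y) $ j * L j (x - \<i> * y)))"
  have bd: "x + \<i> * y \<in> ball 0 2" "x - \<i> * y \<in> ball 0 2" if "x \<in> ball 0 1" "y \<in> ball 0 1" for x y :: complex
    using that norm_triangle_ineq[of x "\<i> * y"] norm_triangle_ineq4[of x "\<i> * y"]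
    by (auto simp: norm_mult)
  have K': "(\<lambda>w. K (k w) $ j) holomorphic_on ball 0 1" "(\<lambda>w. L j (k w)) holomorphic_on ball 0 1"
    if "k holomorphic_on ball 0 1" "k ` ball 0 1 \<subseteq> ball 0 2" for k j
    using holomorphic_on_compose_gen[OF that(1) hol that(2)]
      holomorphic_on_compose_gen[OF that(1) L that(2)] by (simp_all add: o_def)
  have H_real: "H (of_real s) (of_real t) = 0" if "\<bar>s\<bar> < 1" "\<bar>t\<bar> < 1" for s t :: real
    using diag[OF bd(1), of "of_real s" "of_real t"] that
    by (simp add: H_def L_def herm_form_def)
  have H1: "H x (of_real t) = 0" if "x \<in> ball 0 1" "\<bar>t\<bar> < 1" for x and t :: real
  proof (rule holomorphic_zero_of_real_zero[of "\<lambda>x. H x (of_real t)", OF _ _ that(1)])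
    show "(\<lambda>x. H x (of_real t)) holomorphic_on ball 0 1"
      unfolding H_def using bd that(2) by (intro holomorphic_intros K') auto
  qed (use H_real that in auto)
  have "H (1/2) y = 0" if "y \<in> ball 0 1" for y
  proof (rule holomorphic_zero_of_real_zero[OF _ _ that])
    show "(\<lambda>y. H (1/2) y) holomorphic_on ball 0 1"
      unfolding H_def using bd[of "1/2"] by (intro holomorphic_intros K') auto
  qed (use H1[of "1/2"] in auto)
  \<comment> \<open>For \<open>x = 1/2\<close> and \<open>y = \<i>/2\<close> one has
    \<open>x + \<i> * y = 0\<close> and \<open>x - \<i> * y = 1\<close>.\<close>
  from this[of "\<i>/2"] show ?thesis
    by (simp add: H_def L_def herm_form_def)
qed

text \<open>Polarization on discs in complex lines settles pairs of nearby points of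
  \<open>X\<close>; analytic continuation then extends one argument to \<open>W\<close>, and after
  it the other.\<close>

lemma herm_form_polarization:
  fixes f :: "complex^'n \<Rightarrow> complex^'m"
  assumes f: "holo_vec f W" and W: "open W" "convex W"
    and X: "open X" "x \<in> X" "X \<subseteq> W" "\<And>z. z \<in> X \<Longrightarrow> herm_form P N (f z) (f z) = 0"
    and zw: "z \<in> W" "w \<in> W"
  shows "herm_form P N (f z) (f w) = 0"
proof -
  have near: "herm_form P N (f w) (f z) = 0" if "z \<in> X" "w \<in> W" for z w
  proof -
    obtain e where e: "e > 0" "ball z e \<subseteq> X"
      using X(1) \<open>z \<in> X\<close> by (meson open_contains_ball)
    \<comment> \<open>The radius is halved so that, for \<open>v\<close> in the small ball, the disc
      of radius 2 on the line from \<open>z\<close> to \<open>v\<close> stays in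
      \<open>ball z e\<close>.\<close>
    then have "ball z (e/2) \<subseteq> W"
      using X(3) subset_ball[of "e/2" e z] by fastforce
    show ?thesis
    proof (rule holo_on_lines_zero_of_open[OF holo_vec_herm_form[OF f] W, of "ball z (e/2)" z])
      fix v assume v: "v \<in> ball z (e/2)"
      define K where "K = (\<lambda>\<zeta>. f (z + \<zeta> *s (v - z)))"
      have sm: "norm (c *s u) = cmod c * norm u" for c and u :: "complex^'n"
        by (simp add: norm_vec_def norm_mult L2_set_right_distrib)
      have inX: "z + \<zeta> *s (v - z) \<in> X" if "\<zeta> \<in> ball 0 2" for \<zeta>
      proof -
        have "cmod \<zeta> * norm (v - z) \<le> 2 * norm (v - z)"
          using that by (intro mult_right_mono) auto
        also have "\<dots> < e" using v by (simp add: dist_norm norm_minus_commute)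
        finally have "norm (\<zeta> *s (v - z)) < e" unfolding sm .
        moreover have "dist z (z + u) = norm u" for u
          by (simp add: dist_norm)
        ultimately have "z + \<zeta> *s (v - z) \<in> ball z e" by simp
        with e show ?thesis by blast
      qed
      have "herm_form P N (K 0) (K 1) = 0"
      proof (rule herm_form_polarization_disc)
        show "(\<lambda>\<zeta>. K \<zeta> $ j) holomorphic_on ball 0 2" for j
          unfolding K_def using inX X(3)
          by (intro holomorphic_on_subset[OF holo_vec_component_on_line[OF f]]) auto
        show "herm_form P N (K \<zeta>) (K \<zeta>) = 0" if "\<zeta> \<in> ball 0 2" for \<zeta>
          unfolding K_def by (rule X(4)[OF inX[OF that]])
      qed
      then show "herm_form P N (f v) (f z) = 0"
        using herm_form_zero_commute by (auto simp: K_def)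
    qed (use e X that \<open>ball z (e/2) \<subseteq> W\<close> in auto)
  qed
  show ?thesis
    by (rule holo_on_lines_zero_of_open[OF holo_vec_herm_form[OF f] W X(1,2,3) _ zw(1)])
       (use near zw herm_form_zero_commute in blast)
qed

section \<open>The local statement\<close>

text \<open>Cramer's rule, in the form of an exchange lemma: \<open>y\<close> can replace row
  \<open>k\<close> without making the determinant vanish exactly if its coefficient at that row is
  nonzero.\<close>

lemma det_row_exchange:
  fixes A :: "'a::field^'n^'n"
  assumes "det A \<noteq> 0"
  shows "\<exists>c. y = (\<Sum>i\<in>UNIV. c $ i *s A $ i) \<and>
    (\<forall>k. det (\<chi> i. if i = k then y else A $ i) = c $ k * det A)"
proof -
  obtain B where B: "B ** A = mat 1"
    using assms by (meson invertible_det_nz invertible_left_inverse)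
  define c where "c = y v* B"
  have "c v* A = y"
    by (simp add: c_def vector_matrix_mul_assoc B)
  then have y: "y = (\<Sum>i\<in>UNIV. c $ i *s A $ i)"
    by (auto simp: vector_matrix_mult_def vec_eq_iff)
  have row: "row i A = A $ i" for i by (simp add: row_def)
  have "det (\<chi> i. if i = k then y else A $ i) = c $ k * det A" for k
    using cramer_lemma_transpose[of k c A] unfolding row y[symmetric] .
  with y show ?thesis by blast
qed

text \<open>The rows in \<open>I\<close> lie in a coordinate space of dimension
  \<open>card J\<close>, so they are linearly dependent; \<open>x\<close> holds the coefficients of
  a dependence.\<close>

lemma det_zero_of_rows_in_small_support:
  fixes A :: "'a::field^'n^'n"
  assumes "\<And>i j. i \<in> I \<Longrightarrow> j \<notin> J \<Longrightarrow> A $ i $ j = 0" "card J < card I"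
  shows "det A = 0"
proof (rule ccontr)
  assume "det A \<noteq> 0"
  then obtain B where B: "A ** B = mat 1"
    by (meson invertible_det_nz invertible_right_inverse)
  have "card ((\<lambda>j. \<chi> i. A $ i $ j) ` J) < card I"
    by (rule le_less_trans[OF card_image_le assms(2)]) simp
  then obtain x where x: "x \<noteq> 0" "\<And>i. i \<notin> I \<Longrightarrow> x $ i = 0"
    "\<And>a. a \<in> (\<lambda>j. \<chi> i. A $ i $ j) ` J \<Longrightarrow> (\<Sum>i\<in>I. a $ i * x $ i) = 0"
    using homogeneous_system_nontrivial_solution[of "(\<lambda>j. \<chi> i. A $ i $ j) ` J" I] finite by blast
  have "x v* A = 0"
  proof (rule vec_eq_iff[THEN iffD2], rule allI)
    fix j
    have "(x v* A) $ j = (\<Sum>i\<in>I. A $ i $ j * x $ i)"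
      unfolding vector_matrix_mult_def using x(2)
      by (auto simp: mult.commute intro!: sum.mono_neutral_cong_right)
    also have "\<dots> = 0"
      using x(3)[of "\<chi> i. A $ i $ j"] assms(1) by (cases "j \<in> J") auto
    finally show "(x v* A) $ j = 0 $ j" by simp
  qed
  then have "x v* (A ** B) = 0"
    by (simp flip: vector_matrix_mul_assoc)
  with B x(1) show False by simp
qed

text \<open>An isotropic vector whose positive part vanishes lies in the radical.\<close>

lemma herm_form_zero_of_dependent_positive_parts:
  fixes v :: "'m::finite \<Rightarrow> complex^'k::finite"
  assumes iso: "herm_form P N x x = 0" "\<And>i. i \<in> I \<Longrightarrow> herm_form P N x (v i) = 0"
      "\<And>i j. i \<in> I \<Longrightarrow> j \<in> I \<Longrightarrow> herm_form P N (v i) (v j) = 0"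
    and dep: "\<And>j. j \<in> P \<Longrightarrow> x $ j = (\<Sum>i\<in>I. c i * v i $ j)"
    and w: "\<And>i. i \<in> I \<Longrightarrow> herm_form P N (v i) w = 0"
  shows "herm_form P N x w = 0"
proof -
  define s where "s = (\<Sum>i\<in>I. c i *s v i)"
  \<comment> \<open>Subtracting the combination \<open>s\<close> removes the positive part of
    \<open>x\<close> and stays in the isotropic span of \<open>x\<close> and the
    \<open>v i\<close>.\<close>
  define u where "u = x - s"
  have s0: "herm_form P N s y = 0" if "\<And>i. i \<in> I \<Longrightarrow> herm_form P N (v i) y = 0" for y
    using that by (simp add: s_def herm_form_sum_left)
  have "herm_form P N s x = 0" 
    using iso(2) herm_form_zero_commute by (intro s0) blast
  moreover have "herm_form P N s s = 0"
  proof (rule s0)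
    fix i assume "i \<in> I"
    then have "herm_form P N s (v i) = 0" by (intro s0 iso(3))
    then show "herm_form P N (v i) s = 0" using herm_form_zero_commute by blast
  qed
  ultimately have "herm_form P N u u = 0"
    using iso(1) herm_form_zero_commute[of P N x s] by (simp add: u_def herm_form_linear)
  moreover have uP: "u $ j = 0" if "j \<in> P" for j
    using dep[OF that] by (simp add: u_def s_def)
  ultimately have "(\<Sum>j\<in>N. (cmod (u $ j))\<^sup>2) = 0"
    using herm_form_self_Re[of P N u] by simp
  then have "u $ j = 0" if "j \<in> N" for j
    using that by (simp add: sum_nonneg_eq_0_iff)
  with uP have "herm_form P N u w = 0"
    by (simp add: herm_form_def)
  then show ?thesis
    using s0[OF w] by (simp add: u_def herm_form_linear)
qed

section \<open>Isometries between orthogonal complements of positive vectors\<close>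

text \<open>On the orthogonal complement of \<open>z0\<close> this is the reflection in \<open>z0 + c z\<close>, where \<open>c\<close> is chosen
  such that \<open>c z\<close> has the norm of \<open>z0\<close> and a positive product with it. Hence it maps into the
  orthogonal complement of \<open>z\<close>, and it is close to the identity for \<open>z\<close> close to \<open>z0\<close>.\<close>

definition herm_rotation ::
  "'n::finite set \<Rightarrow> 'n set \<Rightarrow> complex^'n \<Rightarrow> complex^'n \<Rightarrow> complex^'n \<Rightarrow> complex^'n" where
  "herm_rotation P N z0 z p = 
    (let g = herm_form P N z0 z; N0 = Re (herm_form P N z0 z0); N1 = Re (herm_form P N z z);
         D = cmod g + sqrt (N0 * N1); s = herm_form P N p z
     in p - (s * (cnj g / of_real (cmod g * D))) *s z0 - (s * of_real (sqrt (N0 / N1) / D)) *s z)"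

text \<open>The form at the mirror vector \<open>z0 + c z\<close> equals
  \<open>2 * sqrt (N0 / N1) * D\<close>, and \<open>a\<close>, \<open>b\<close> are the resulting
  coefficients of \<open>z0\<close> and \<open>z\<close> per unit of the product with
  \<open>z\<close>. Both claims thus become scalar identities; orthogonality is
  \<open>a * g + b * N1 = 1\<close>.\<close>

lemma herm_rotation:
  assumes z0: "Re (herm_form P N z0 z0) > 0" and z: "Re (herm_form P N z z) > 0"
    and g: "herm_form P N z0 z \<noteq> 0"
    and p: "herm_form P N p z0 = 0"
  shows herm_rotation_orthogonal: "herm_form P N (herm_rotation P N z0 z p) z = 0"
    and herm_rotation_isometry: "herm_form P N q z0 = 0 \<Longrightarrow> 
      herm_form P N (herm_rotation P N z0 z p) (herm_rotation P N z0 z q) = herm_form P N p q"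
proof -
  define g where "g = herm_form P N z0 z"
  define N0 where "N0 = Re (herm_form P N z0 z0)"
  define N1 where "N1 = Re (herm_form P N z z)"
  define D where "D = cmod g + sqrt (N0 * N1)"
  define a where "a = cnj g / of_real (cmod g * D)"
  define b where "b = sqrt (N0 / N1) / D"
  have pos: "cmod g > 0" "N0 > 0" "N1 > 0" "D > 0"
    using assms by (auto simp: g_def N0_def N1_def D_def intro!: add_pos_nonneg)
  have forms: "herm_form P N z0 z = g" "herm_form P N z z0 = cnj g"
    "herm_form P N z0 z0 = of_real N0" "herm_form P N z z = of_real N1"
    by (simp_all add: g_def N0_def N1_def cnj_herm_form flip: herm_form_self_real)
  have rot: "herm_rotation P N z0 z x =
      x - (herm_form P N x z * a) *s z0 - (herm_form P N x z * of_real b) *s z" for x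
    unfolding herm_rotation_def Let_def a_def b_def D_def g_def N0_def N1_def by simp
  have gg: "cnj g * g = of_real (cmod g) * of_real (cmod g)"
    using complex_norm_square[of g] by (simp only: power2_eq_square mult.commute of_real_mult)
  have "a * g = (cnj g * g) / (of_real (cmod g) * of_real D)"
    by (simp add: a_def)
  then have ag: "a * g = of_real (cmod g / D)"
    using pos unfolding gg by simp
  have "a * cnj a = (cnj g * g) / (of_real (cmod g) * of_real (cmod g) * of_real D * of_real D)"
    by (simp add: a_def)
  then have aa: "a * cnj a = of_real (1 / D\<^sup>2)"
    using pos unfolding gg by (simp add: power2_eq_square)
  have bN: "b * N1 = sqrt (N0 * N1) / D"
    using pos by (simp add: b_def real_sqrt_divide real_sqrt_mult field_simps)
  have bbN: "b * b * N1 = N0 / D\<^sup>2"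
    using pos by (simp add: b_def power2_eq_square)
  have one: "a * g + of_real (b * N1) = 1"
    unfolding ag bN of_real_add[symmetric] add_divide_distrib[symmetric] using pos by (simp add: D_def)
  show "herm_form P N (herm_rotation P N z0 z p) z = 0"
  proof -
    have "herm_form P N (herm_rotation P N z0 z p) z
        = herm_form P N p z * (1 - (a * g + of_real (b * N1)))"
      by (simp add: rot herm_form_linear forms algebra_simps)
    then show ?thesis using one by simp
  qed
  show "herm_form P N (herm_rotation P N z0 z p) (herm_rotation P N z0 z q) = herm_form P N p q"
    if q: "herm_form P N q z0 = 0"
  proof -
    let ?s = "herm_form P N p z" and ?t = "herm_form P N q z"
    have "herm_form P N z0 q = 0" "herm_form P N z q = cnj ?t"
      using q herm_form_zero_commute cnj_herm_form by metis+
    \<comment> \<open>Since \<open>p\<close> and \<open>q\<close> are orthogonal to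
      \<open>z0\<close>, every correction term is a multiple of \<open>?s * cnj ?t\<close>; it
      remains to show that the total coefficient is zero.\<close>
    then have "herm_form P N (herm_rotation P N z0 z p) (herm_rotation P N z0 z q)
        = herm_form P N p q + ?s * cnj ?t * (a * cnj a * of_real N0 + of_real (b * b * N1)
          + of_real b * (a * g) + of_real b * cnj (a * g) - 2 * of_real b)"
      using p by (simp add: rot herm_form_linear forms algebra_simps)
    also have "a * cnj a * of_real N0 + of_real (b * b * N1)
          + of_real b * (a * g) + of_real b * cnj (a * g) - 2 * of_real b = 
        of_real (2 * N0 / D\<^sup>2 + 2 * b * (cmod g / D) - 2 * b)"
      unfolding aa bbN ag by simp
    also have "2 * N0 / D\<^sup>2 + 2 * b * (cmod g / D) - 2 * b = 0"
    proof -
      have "cmod g / D = 1 - sqrt (N0 * N1) / D"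
        using pos by (simp add: D_def field_simps)
      moreover have "b * (sqrt (N0 * N1) / D) = N0 / D\<^sup>2"
        using bbN bN by (simp add: mult.assoc)
      ultimately have "b * (cmod g / D) = b - N0 / D\<^sup>2"
        by (simp only: right_diff_distrib mult_1_right)
      then have "2 * b * (cmod g / D) = 2 * (b - N0 / D\<^sup>2)"
        by (simp only: mult.assoc)
      then show ?thesis by simp
    qed
    finally show ?thesis by simp
  qed
qed

text \<open>At \<open>z = z0\<close> both corrections carry the factor
  \<open>herm_form P N p z0 = 0\<close>, while the denominators stay away from zero because
  \<open>z0\<close> is positive.\<close>

lemma tendsto_herm_rotation:
  assumes z0: "Re (herm_form P N z0 z0) > 0" and p: "herm_form P N p z0 = 0"
  shows "((\<lambda>z. herm_rotation P N z0 z p) \<longlongrightarrow> p) (nhds z0)"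
proof -
  have [simp]: "herm_form P N z0 z0 \<noteq> 0" using z0 by auto
  have id: "((\<lambda>z. z) \<longlongrightarrow> z0) (nhds z0)" by (simp add: filterlim_ident)
  have "cmod (herm_form P N z0 z0) + sqrt (Re (herm_form P N z0 z0) * Re (herm_form P N z0 z0)) \<noteq> 0"
    using z0 by (smt (verit) norm_ge_zero mult_pos_pos real_sqrt_gt_zero)
  then have "((\<lambda>z. herm_rotation P N z0 z p) \<longlongrightarrow> herm_rotation P N z0 z0 p) (nhds z0)"
    unfolding herm_rotation_def Let_def using z0
    by (intro tendsto_intros id) (auto simp flip: of_real_add)
  moreover have "herm_rotation P N z0 z0 p = p"
    by (simp add: herm_rotation_def Let_def p)
  ultimately show ?thesis by simp
qed

text \<open>The null vector \<open>p\<close> is moved slightly along a positive vector orthogonal to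
  \<open>A\<close>, which preserves orthogonality to \<open>A\<close>.\<close>

lemma ex_positive_orthogonal_near:
  fixes W :: "(complex^'n) set"
  assumes "P \<inter> N = {}" "finite A" "card A < card P" and W: "open W" "p \<in> W" "herm_form P N p p = 0"
    and p: "\<And>a. a \<in> A \<Longrightarrow> herm_form P N p a = 0"
  obtains x where "x \<in> W" "Re (herm_form P N x x) > 0" "\<And>a. a \<in> A \<Longrightarrow> herm_form P N x a = 0"
proof -
  obtain e where e: "Re (herm_form P N e e) > 0" "\<And>a. a \<in> A \<Longrightarrow> herm_form P N e a = 0"
    using ex_definite_vector_orthogonal[OF assms(1-3)] by blast
  obtain t :: real where "p + of_real t *s e \<in> W"
    "Re (herm_form P N (p + of_real t *s e) (p + of_real t *s e)) > 0"
    using herm_form_sign_near[OF W e(1)] by blast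
  then show thesis
    using that e(2) p by (simp add: herm_form_linear)
qed

lemma complex_subspace_orthogonal: "complex_subspace {x. \<forall>a\<in>A. herm_form P N x a = 0}"
  by (auto simp: complex_subspace_def herm_form_linear) (simp add: herm_form_def)

text \<open>An independent family has at most \<open>card P'\<close> members; this is less than both
  \<open>card P\<close> and \<open>card N\<close>, so vectors of both signs remain orthogonal to
  it.\<close>

lemma local_orthogonal_isotropic_le:
  fixes f :: "complex^'n \<Rightarrow> complex^'m"
  assumes disj: "P \<inter> N = {}"
    and card: "card P' < card P" "card P' < card N"
    and W: "open W" "convex W" and f: "holo_vec f W"
    and orth: "\<And>z w. z \<in> W \<Longrightarrow> w \<in> W \<Longrightarrow> herm_form P N z w = 0 \<Longrightarrow> herm_form P' N' (f z) (f w) = 0"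
    and p0: "p0 \<in> W" "herm_form P N p0 p0 = 0"
    and zw: "z \<in> W" "w \<in> W"
  shows "herm_form P' N' (f z) (f w) = 0"
proof -
  define pos :: "complex^'m \<Rightarrow> complex^'m" where "pos = (\<lambda>x. \<chi> j. if j \<in> P' then x $ j else 0)"
  \<comment> \<open>The vectors \<open>b i\<close> fill the rows outside \<open>I\<close>, so that a
    nonzero determinant expresses independence of the rows in \<open>I\<close>. In this form
    independence is an open condition, and prolonging the family amounts to exchanging a
    row.\<close>
  define M :: "'m set \<Rightarrow> ('m \<Rightarrow> complex^'n) \<Rightarrow> ('m \<Rightarrow> complex^'m) \<Rightarrow> complex^'m^'m"
    where "M = (\<lambda>I p b. \<chi> i. if i \<in> I then pos (f (p i)) else b i)"
  \<comment> \<open>The images of the pairwise orthogonal null vectors \<open>p i\<close> are linearly independent modulo the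
    radical: an isotropic subspace embeds, modulo the radical, into its positive part.\<close>
  define indep where "indep = (\<lambda>I p b. (\<forall>i\<in>I. p i \<in> W) \<and>
    (\<forall>i\<in>I. \<forall>j\<in>I. herm_form P N (p i) (p j) = 0) \<and> det (M I p b) \<noteq> 0)"
  have le: "card I \<le> card P'" if "indep I p b" for I p b
  proof (rule ccontr)
    assume "\<not> card I \<le> card P'"
    then have "det (M I p b) = 0"
      by (intro det_zero_of_rows_in_small_support[of I P']) (auto simp: M_def pos_def)
    with that show False by (simp add: indep_def)
  qed
  have "M {} p (\<lambda>i. axis i 1) = mat 1" for p
    by (simp add: M_def mat_def axis_def vec_eq_iff)
  then have "indep {} (\<lambda>_. 0) (\<lambda>i. axis i 1)"
    by (simp add: indep_def)
  then have "\<exists>I. \<exists>p b. indep I p b" by blast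
  \<comment> \<open>The size is maximal among all families and all fillings \<open>b\<close>, so it
    can be played off against any other family indexed by \<open>I\<close>, in particular the
    rotated ones.\<close>
  then obtain I where I: "\<exists>p b. indep I p b" "\<And>J p b. indep J p b \<Longrightarrow> card J \<le> card I"
    using ex_has_greatest_nat[of "\<lambda>I. \<exists>p b. indep I p b" _ card "Suc (card P')"] le
    by (metis less_Suc_eq_le)
  obtain p b where pb: "indep I p b" using I(1) by blast
  have card': "card (q ` I) < card P" "card (q ` I) < card N" for q :: "'m \<Rightarrow> complex^'n"
    using card le[OF pb] card_image_le[of I q] by auto

  have signs: "\<exists>x. x \<in> W \<and> Re (herm_form P N x x) > 0 \<and> (\<forall>i\<in>I. herm_form P N x (q i) = 0)"
    "\<exists>x. x \<in> W \<and> Re (herm_form P N x x) < 0 \<and> (\<forall>i\<in>I. herm_form P N x (q i) = 0)"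
    if q: "indep I q b" for q
  proof -
    \<comment> \<open>A null vector orthogonal to the family is needed as the starting point of the
      perturbation: any member of the family will do, or \<open>p0\<close> if there is none.\<close>
    obtain y where y: "y \<in> W" "herm_form P N y y = 0" "\<And>i. i \<in> I \<Longrightarrow> herm_form P N y (q i) = 0"
    proof (cases "I = {}")
      case True
      then show thesis using that p0 by blast
    next
      case False
      then obtain i where "i \<in> I" by blast
      then show thesis using that[of "q i"] q by (simp add: indep_def)
    qed
    have fin: "finite (q ` I)" by (rule finite_imageI[OF finite])
    have yP: "herm_form P N y a = 0" if "a \<in> q ` I" for a
      using y(3) that by blast
    then obtain x where "x \<in> W" "Re (herm_form P N x x) > 0" "\<And>a. a \<in> q ` I \<Longrightarrow> herm_form P N x a = 0"
      using ex_positive_orthogonal_near[OF disj fin card'(1) W(1) y(1,2)] by blast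
    then show "\<exists>x. x \<in> W \<and> Re (herm_form P N x x) > 0 \<and> (\<forall>i\<in>I. herm_form P N x (q i) = 0)"
      by blast
    \<comment> \<open>Negative vectors are the positive vectors of the form with \<open>P\<close>
      and \<open>N\<close> exchanged.\<close>
    have "N \<inter> P = {}" using disj by blast
    moreover have "herm_form N P y y = 0" using y(2) by (simp add: herm_form_swap[of N P])
    moreover have "herm_form N P y a = 0" if "a \<in> q ` I" for a
      using yP[OF that] by (simp add: herm_form_swap[of N P])
    ultimately obtain x where "x \<in> W" "Re (herm_form N P x x) > 0"
      "\<And>a. a \<in> q ` I \<Longrightarrow> herm_form N P x a = 0"
      using ex_positive_orthogonal_near[OF _ fin card'(2) W(1) y(1)] by blast
    then show "\<exists>x. x \<in> W \<and> Re (herm_form P N x x) < 0 \<and> (\<forall>i\<in>I. herm_form P N x (q i) = 0)"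
      by (intro exI[of _ x]) (auto simp: herm_form_swap[of N P])
  qed

  have isotropic: "herm_form P' N' (f z) (f w) = 0"
    if q: "indep I q b" and z: "z \<in> W" "\<And>i. i \<in> I \<Longrightarrow> herm_form P N z (q i) = 0"
      and w: "w \<in> W" "\<And>i. i \<in> I \<Longrightarrow> herm_form P N w (q i) = 0" for q z w
  proof -
    define V where "V = {x. \<forall>a\<in>q ` I. herm_form P N x a = 0}"
    have null: "herm_form P' N' (f x) (f w) = 0" if x: "x \<in> V \<inter> W" "herm_form P N x x = 0" for x
    proof -
      have detM: "det (M I q b) \<noteq> 0" using q by (simp add: indep_def)
      obtain c where c: "pos (f x) = (\<Sum>i\<in>UNIV. c $ i *s M I q b $ i)"
        "\<And>k. det (\<chi> i. if i = k then pos (f x) else M I q b $ i) = c $ k * det (M I q b)"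
        using det_row_exchange[OF detM, of "pos (f x)"] by blast
      \<comment> \<open>With a nonzero coefficient at \<open>k\<close>, the filler
        \<open>b k\<close> could be exchanged for \<open>pos (f x)\<close>, so that \<open>x\<close>
        would prolong the maximal family.\<close>
      have c0: "c $ k = 0" if "k \<notin> I" for k
      proof (rule ccontr)
        assume "c $ k \<noteq> 0"
        have "M (insert k I) (q(k := x)) b = (\<chi> i. if i = k then pos (f x) else M I q b $ i)"
          using that by (auto simp: M_def vec_eq_iff)
        then have "det (M (insert k I) (q(k := x)) b) \<noteq> 0"
          using c(2)[of k] \<open>c $ k \<noteq> 0\<close> q by (simp add: indep_def)
        moreover have "herm_form P N x (q i) = 0" "herm_form P N (q i) x = 0" if "i \<in> I" for i
          using that x(1) herm_form_zero_commute[of P N x] by (auto simp: V_def)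
        ultimately have "indep (insert k I) (q(k := x)) b"
          using x q that unfolding indep_def by (auto simp: fun_upd_def)
        then have "card (insert k I) \<le> card I" by (rule I(2))
        then show False using that by simp
      qed
      show ?thesis
      proof (rule herm_form_zero_of_dependent_positive_parts[of _ _ "f x" I "\<lambda>i. f (q i)" "\<lambda>i. c $ i"])
        fix j assume "j \<in> P'"
        then have "f x $ j = pos (f x) $ j" by (simp add: pos_def)
        also have "\<dots> = (\<Sum>i\<in>UNIV. c $ i * M I q b $ i $ j)" by (subst c(1)) simp
        also have "\<dots> = (\<Sum>i\<in>I. c $ i * f (q i) $ j)"
          using c0 \<open>j \<in> P'\<close> by (intro sum.mono_neutral_cong_right) (auto simp: M_def pos_def)
        finally show "f x $ j = (\<Sum>i\<in>I. c $ i * f (q i) $ j)" .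
      next
        fix i assume "i \<in> I"
        then show "herm_form P' N' (f (q i)) (f w) = 0"
          using q w herm_form_zero_commute unfolding indep_def by (blast intro: orth)
      qed (use x q in \<open>auto simp: V_def indep_def intro!: orth\<close>)
    qed
    \<comment> \<open>Both signs occur on \<open>V \<inter> W\<close>, so the vanishing at the null
      vectors of \<open>V\<close> spreads to all of \<open>V \<inter> W\<close>.\<close>
    obtain x y where x: "x \<in> W" "Re (herm_form P N x x) > 0" "\<forall>i\<in>I. herm_form P N x (q i) = 0"
      and y: "y \<in> W" "Re (herm_form P N y y) < 0" "\<forall>i\<in>I. herm_form P N y (q i) = 0"
      using signs[OF q] by blast
    have V: "x \<in> V \<inter> W" "y \<in> V \<inter> W" "z \<in> V \<inter> W"
      using x y z by (auto simp: V_def)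
    have "complex_subspace V"
      unfolding V_def by (rule complex_subspace_orthogonal)
    then show ?thesis
      by (rule holo_on_lines_zero_of_null[OF holo_vec_herm_form[OF f] W _ null V(1) x(2) V(2) y(2) V(3)])
  qed

  \<comment> \<open>The orthogonal complement of a single family need not contain an open set.
    Rotating the family along with \<open>z\<close> puts every \<open>z\<close> near
    \<open>z0\<close> into the complement of a family that is still independent by continuity; a
    positive \<open>z0\<close> makes the rotation available.\<close>
  obtain z0 where z0: "z0 \<in> W" "Re (herm_form P N z0 z0) > 0" "\<And>i. i \<in> I \<Longrightarrow> herm_form P N z0 (p i) = 0"
    using signs(1)[OF pb] by blast
  define p' where "p' = (\<lambda>z i. herm_rotation P N z0 z (p i))"
  have p_z0: "herm_form P N (p i) z0 = 0" if "i \<in> I" for i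
    using z0(3)[OF that] herm_form_zero_commute by blast
  have id: "((\<lambda>z. z) \<longlongrightarrow> z0) (nhds z0)" by (simp add: filterlim_ident)
  have p': "((\<lambda>z. p' z i) \<longlongrightarrow> p i) (nhds z0)" if "i \<in> I" for i
    unfolding p'_def by (rule tendsto_herm_rotation[OF z0(2) p_z0[OF that]])
  have fp': "((\<lambda>z. f (p' z i)) \<longlongrightarrow> f (p i)) (nhds z0)" if "i \<in> I" for i
  proof (rule isCont_tendsto_compose[OF _ p'[OF that]])
    have "p i \<in> W" using pb that by (simp add: indep_def)
    then show "isCont f (p i)"
      using f has_derivative_continuous unfolding holo_vec_def by blast
  qed
  have "((\<lambda>z. M I (p' z) b $ i) \<longlongrightarrow> M I p b $ i) (nhds z0)" for i
  proof (cases "i \<in> I")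
    case True
    have "((\<lambda>z. pos (f (p' z i)) $ j) \<longlongrightarrow> pos (f (p i)) $ j) (nhds z0)" for j
      using tendsto_vec_nth[OF fp'[OF True], of j] by (simp add: pos_def)
    with True show ?thesis by (auto simp: M_def intro: vec_tendstoI)
  qed (simp add: M_def)
  then have "((\<lambda>z. det (M I (p' z) b)) \<longlongrightarrow> det (M I p b)) (nhds z0)"
    by (rule tendsto_det[OF vec_tendstoI])
  then have "\<forall>\<^sub>F z in nhds z0. det (M I (p' z) b) \<noteq> 0"
    using pb by (intro tendsto_imp_eventually_ne) (auto simp: indep_def)
  moreover have "\<forall>\<^sub>F z in nhds z0. \<forall>i\<in>I. p' z i \<in> W"
    using p' pb W(1) by (intro eventually_ball_finite) (auto simp: indep_def dest: topological_tendstoD)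
  moreover have "\<forall>\<^sub>F z in nhds z0. z \<in> W"
    using z0(1) W(1) by (rule eventually_nhds_in_open[rotated])
  moreover have "\<forall>\<^sub>F z in nhds z0. Re (herm_form P N z z) > 0"
    by (rule order_tendstoD(1)[OF _ z0(2)]) (intro tendsto_intros id)
  moreover have "\<forall>\<^sub>F z in nhds z0. herm_form P N z0 z \<noteq> 0"
  proof (rule tendsto_imp_eventually_ne)
    show "((\<lambda>z. herm_form P N z0 z) \<longlongrightarrow> herm_form P N z0 z0) (nhds z0)"
      by (intro tendsto_intros id)
  qed (use z0(2) in auto)
  ultimately have "\<forall>\<^sub>F z in nhds z0. z \<in> W \<and> herm_form P' N' (f z) (f z) = 0"
  proof eventually_elim
    case (elim z)
    have "herm_form P N (p' z i) (p' z j) = 0" if "i \<in> I" "j \<in> I" for i j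
      using herm_rotation_isometry[OF z0(2) elim(4,5) p_z0[OF that(1)] p_z0[OF that(2)]] pb that
      by (simp add: p'_def indep_def)
    then have "indep I (p' z) b"
      using elim by (simp add: indep_def)
    moreover have "herm_form P N z (p' z i) = 0" if "i \<in> I" for i
      using herm_rotation_orthogonal[OF z0(2) elim(4,5) p_z0[OF that]] herm_form_zero_commute
      unfolding p'_def by blast
    ultimately show ?case
      using isotropic elim(3) by blast
  qed
  then obtain X where X: "open X" "z0 \<in> X" "\<And>z. z \<in> X \<Longrightarrow> z \<in> W \<and> herm_form P' N' (f z) (f z) = 0"
    unfolding eventually_nhds by blast
  then show ?thesis
    by (intro herm_form_polarization[OF f W X(1,2) _ _ zw]) blast+
qed

text \<open>Changing the sign of the target form exchanges \<open>P'\<close> and \<open>N'\<close>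
  and preserves orthogonality, so \<open>P'\<close> may be taken to be the smaller set.\<close>

lemma local_orthogonal_isotropic:
  fixes f :: "complex^'n \<Rightarrow> complex^'m"
  assumes disj: "P \<inter> N = {}"
    and card: "min (card P') (card N') < min (card P) (card N)"
    and W: "open W" "convex W" and f: "holo_vec f W"
    and orth: "\<And>z w. z \<in> W \<Longrightarrow> w \<in> W \<Longrightarrow> herm_form P N z w = 0 \<Longrightarrow> herm_form P' N' (f z) (f w) = 0"
    and p0: "p0 \<in> W" "herm_form P N p0 p0 = 0"
    and zw: "z \<in> W" "w \<in> W"
  shows "herm_form P' N' (f z) (f w) = 0"
proof (cases "card P' \<le> card N'")
  case True
  then show ?thesis
    using card by (intro local_orthogonal_isotropic_le[OF disj _ _ W f orth p0 zw]) auto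
next
  case False
  have "herm_form N' P' (f z) (f w) = 0"
    using card False
    by (intro local_orthogonal_isotropic_le[OF disj _ _ W f _ p0 zw])
       (auto simp: herm_form_swap[of N' P'] orth)
  then show ?thesis by (simp add: herm_form_swap[of N' P'])
qed

section \<open>The global statement\<close>

text \<open>This is the complex linear span, written as the common zero set of the functionals that
  vanish on \<open>S\<close>; analytic continuation can then be applied to each functional
  separately.\<close>

definition annihilator_hull :: "(complex^'m) set \<Rightarrow> (complex^'m) set" where
  "annihilator_hull S =
    {y. \<forall>c :: complex^'m. (\<forall>x\<in>S. (\<Sum>j\<in>UNIV. c $ j * x $ j) = 0) \<longrightarrow> (\<Sum>j\<in>UNIV. c $ j * y $ j) = 0}"

lemma subset_annihilator_hull: "S \<subseteq> annihilator_hull S"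
  by (auto simp: annihilator_hull_def)

lemma complex_subspace_annihilator_hull: "complex_subspace (annihilator_hull S)"
proof -
  have "(\<Sum>j\<in>UNIV. c $ j * (x + y) $ j) = (\<Sum>j\<in>UNIV. c $ j * x $ j) + (\<Sum>j\<in>UNIV. c $ j * y $ j)"
    for c x y :: "complex^'a"
    by (simp add: distrib_left sum.distrib)
  moreover have "(\<Sum>j\<in>UNIV. c $ j * (a *s x) $ j) = a * (\<Sum>j\<in>UNIV. c $ j * x $ j)"
    for a and c x :: "complex^'a"
    by (simp add: sum_distrib_left mult.left_commute)
  ultimately show ?thesis
    by (simp add: complex_subspace_def annihilator_hull_def)
qed

text \<open>For fixed \<open>w\<close> the form is one of the functionals that define the hull.
  Using this in one argument and then, by Hermitian symmetry, in the other extends the vanishing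
  from \<open>S\<close> to the hull.\<close>

lemma null_space_annihilator_hull:
  fixes S :: "(complex^'m) set"
  assumes "\<And>x y. x \<in> S \<Longrightarrow> y \<in> S \<Longrightarrow> herm_form P N x y = 0"
  shows "null_space P N (annihilator_hull S)"
proof -
  have kill: "herm_form P N y w = 0"
    if "y \<in> annihilator_hull S" and w: "\<And>x. x \<in> S \<Longrightarrow> herm_form P N x w = 0" for y w
  proof -
    define c :: "complex^'m" where
      "c = (\<chi> j. (if j \<in> P then cnj (w $ j) else 0) - (if j \<in> N then cnj (w $ j) else 0))"
    have c: "herm_form P N x w = (\<Sum>j\<in>UNIV. c $ j * x $ j)" for x
      unfolding herm_form_eq_sum_UNIV by (simp add: c_def)
    then show ?thesis
      using that unfolding annihilator_hull_def by simp
  qed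
  have "herm_form P N z w = 0" if "z \<in> annihilator_hull S" "w \<in> annihilator_hull S" for z w
    using kill[OF that(1)] kill[OF that(2)] assms herm_form_zero_commute by metis
  then show ?thesis
    by (simp add: null_space_def complex_subspace_annihilator_hull)
qed

section \<open>Points of projective space and the vectors representing them\<close>

lemma mem_proj_self: "z \<in> proj z"
  unfolding proj_def by (auto intro!: exI[of _ 1])

lemma proj_smult: "c \<noteq> 0 \<Longrightarrow> z \<noteq> 0 \<Longrightarrow> proj (c *s z) = proj z"
  by (rule proj_eq_if_meet[of "c *s z"]) (use mem_proj_self in \<open>auto simp: proj_def\<close>)

lemma mem_Union_Pspace_iff:
  assumes "U \<subseteq> Pspace"
  shows "x \<in> \<Union>U \<longleftrightarrow> x \<noteq> 0 \<and> proj x \<in> U"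
proof
  assume "x \<in> \<Union>U"
  then obtain z where z: "proj z \<in> U" "z \<noteq> 0" "x \<in> proj z"
    using assms unfolding Pspace_def by blast
  then obtain c where "c \<noteq> 0" "x = c *s z" unfolding proj_def by blast
  with z show "x \<noteq> 0 \<and> proj x \<in> U" by (simp add: proj_smult)
qed (use mem_proj_self in blast)

lemma proj_subset_iff:
  assumes "complex_subspace H"
  shows "proj z \<subseteq> H \<longleftrightarrow> z \<in> H"
  using assms mem_proj_self unfolding complex_subspace_def proj_def by blast

lemma proj_orth_iff: "proj_orth P N (proj z) (proj w) \<longleftrightarrow> herm_form P N z w = 0"
proof
  assume "herm_form P N z w = 0"
  then show "proj_orth P N (proj z) (proj w)"
    by (auto simp: proj_orth_def proj_def herm_form_linear)
qed (use mem_proj_self in \<open>auto simp: proj_orth_def\<close>)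

lemma openin_proj_top_iff:
  "openin (proj_top :: (complex^'n::finite) set topology) S \<longleftrightarrow> proj_open S"
  by (simp add: proj_top_def topology_inverse' istopology_proj_open)

text \<open>A continuation principle: the interior of \<open>Q\<close> is a cone, and by
  \<open>chart\<close> it is relatively closed in \<open>\<Union>U\<close>. It therefore splits
  \<open>U\<close> into two open parts, of which the one containing the point of \<open>x0\<close>
  must be everything.\<close>

lemma connectedin_proj_top_induct:
  fixes U :: "(complex^'n) set set"
  assumes U: "openin proj_top U" "connectedin proj_top U"
    and x0: "X0 \<subseteq> Q" "open X0" "x0 \<in> X0" "x0 \<in> \<Union>U"
    and Q: "\<And>x c. x \<in> Q \<Longrightarrow> c \<noteq> 0 \<Longrightarrow> c *s x \<in> Q"
    and chart: "\<And>x. x \<in> \<Union>U \<Longrightarrow> \<exists>W. open W \<and> x \<in> W \<and>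
      (\<forall>X. open X \<longrightarrow> X \<subseteq> W \<inter> Q \<longrightarrow> X \<noteq> {} \<longrightarrow> W \<subseteq> Q)"
  shows "\<Union>U \<subseteq> Q"
proof -
  define S where "S = interior Q"
  have UP: "U \<subseteq> Pspace" "open (\<Union>U)"
    using U(1) unfolding openin_proj_top_iff proj_open_def by auto
  \<comment> \<open>Multiplication by \<open>c\<close> is a homeomorphism preserving
    \<open>Q\<close>, hence also its interior; only then does membership in \<open>S\<close> depend
    on the projective point alone.\<close>
  have S_scale: "c *s x \<in> S" if "x \<in> S" "c \<noteq> 0" for c x
  proof -
    define T where "T = (\<lambda>y. (1 / c) *s y) -` S"
    have "continuous_on UNIV (\<lambda>y::complex^'n. (1 / c) *s y)"
      by (intro continuous_intros)
    then have "open T"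
      unfolding T_def S_def by (intro open_vimage) auto
    moreover have "T \<subseteq> Q"
    proof
      fix y assume "y \<in> T"
      then have "(1 / c) *s y \<in> Q"
        using interior_subset[of Q] unfolding T_def S_def by blast
      from Q[OF this that(2)] show "y \<in> Q" using that(2) by simp
    qed
    moreover have "c *s x \<in> T"
      using that by (simp add: T_def)
    ultimately show ?thesis
      unfolding S_def by (meson interiorI)
  qed
  have S_proj: "x \<in> S \<longleftrightarrow> proj x \<subseteq> S" for x
    using S_scale mem_proj_self unfolding proj_def by blast
  define E1 where "E1 = {p \<in> U. p \<subseteq> S}"
  define E2 where "E2 = {p \<in> U. \<not> p \<subseteq> S}"
  have sub: "E1 \<subseteq> Pspace" "E2 \<subseteq> Pspace" using UP by (auto simp: E1_def E2_def)
  have mem: "x \<in> \<Union>E1 \<longleftrightarrow> x \<in> \<Union>U \<and> x \<in> S" "x \<in> \<Union>E2 \<longleftrightarrow> x \<in> \<Union>U \<and> x \<notin> S" for x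
    unfolding mem_Union_Pspace_iff[OF sub(1)] mem_Union_Pspace_iff[OF sub(2)]
      mem_Union_Pspace_iff[OF UP(1)] S_proj by (auto simp: E1_def E2_def)
  have "\<Union>E1 = \<Union>U \<inter> S" using mem(1) by blast
  then have "openin proj_top E1"
    using UP sub unfolding openin_proj_top_iff proj_open_def by (simp add: S_def open_Int)
  moreover have "open (\<Union>E2)"
  proof (subst open_subopen, intro ballI)
    fix x assume "x \<in> \<Union>E2"
    then have x: "x \<in> \<Union>U" "x \<notin> S" using mem by auto
    obtain W where W: "open W" "x \<in> W" "\<And>X. open X \<Longrightarrow> X \<subseteq> W \<inter> Q \<Longrightarrow> X \<noteq> {} \<Longrightarrow> W \<subseteq> Q"
      using chart[OF x(1)] by blast
    have "W \<inter> S = {}"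
    proof (rule ccontr)
      assume "W \<inter> S \<noteq> {}"
      then have "W \<subseteq> Q"
        using W(1) interior_subset[of Q] by (intro W(3)[of "W \<inter> S"]) (auto simp: S_def)
      with W x(2) show False unfolding S_def by (meson interiorI)
    qed
    then show "\<exists>T. open T \<and> x \<in> T \<and> T \<subseteq> \<Union>E2"
      using W x(1) UP(2) mem(2) by (intro exI[of _ "W \<inter> \<Union>U"]) blast
  qed
  then have "openin proj_top E2"
    using sub unfolding openin_proj_top_iff proj_open_def by simp
  moreover have "x0 \<in> S" unfolding S_def using x0 by (meson interiorI)
  then have "x0 \<in> \<Union>E1" using mem(1) x0(4) by blast
  then have "E1 \<inter> U \<noteq> {}" unfolding E1_def by blast
  ultimately have "E2 \<inter> U = {}"
    using U(2) unfolding connectedin E1_def E2_def by blast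
  then have "E2 = {}" by (auto simp: E2_def)
  then have "\<Union>U \<subseteq> S" using mem(2) by blast
  then show ?thesis using interior_subset[of Q] unfolding S_def by blast
qed

theorem mainTheorem8:
  fixes Pos Neg :: "'n::finite set" and Pos' Neg' :: "'m::finite set"
    and F :: "(complex^'n) set \<Rightarrow> (complex^'m) set" and U :: "(complex^'n) set set"
  assumes "Pos \<inter> Neg = {}" and "Pos' \<inter> Neg' = {}"
    and "min (card Pos') (card Neg') < min (card Pos) (card Neg)"
    and "local_orthogonal_map Pos Neg Pos' Neg' F U"
  shows "null_map Pos' Neg' F U"
proof -
  have U: "openin proj_top U" "connectedin proj_top U"
    and holo: "proj_holomorphic F U"
    and orth: "\<And>p q. p \<in> U \<Longrightarrow> q \<in> U \<Longrightarrow> proj_orth Pos Neg p q \<Longrightarrow> proj_orth Pos' Neg' (F p) (F q)"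
    using assms(4) unfolding local_orthogonal_map_def by blast+
  obtain P0 where P0: "P0 \<in> U" "null_point Pos Neg P0"
    using assms(4) unfolding local_orthogonal_map_def by blast
  have UP: "U \<subseteq> Pspace"
    using U(1) unfolding openin_proj_top_iff proj_open_def by blast
  have chart: "\<exists>W f. open W \<and> convex W \<and> x \<in> W \<and> W \<subseteq> \<Union>U \<and> holo_vec f W \<and>
      (\<forall>w\<in>W. f w \<noteq> 0 \<and> F (proj w) = proj (f w))" if x: "x \<in> \<Union>U" for x
  proof -
    obtain W f where W: "open W" "x \<in> W" "W \<subseteq> \<Union>U" "holo_vec f W"
      "\<forall>w\<in>W. f w \<noteq> 0 \<and> F (proj w) = proj (f w)"
      using holo x unfolding proj_holomorphic_def mem_Union_Pspace_iff[OF UP] by blast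
    \<comment> \<open>Shrinking the chart to a ball makes the domain of the lift convex.\<close>
    obtain e where e: "e > 0" "ball x e \<subseteq> W"
      using W(1,2) by (meson open_contains_ball)
    show ?thesis
      using W(3-5) e
      by (intro exI[of _ "ball x e"] exI[of _ f]) (auto simp: holo_vec_def)
  qed

  obtain x0 where x0: "P0 = proj x0" "x0 \<noteq> 0"
    using P0(1) UP unfolding Pspace_def by blast
  then have x0U: "x0 \<in> \<Union>U" using P0(1) mem_proj_self by blast
  obtain W f where W: "open W" "convex W" "x0 \<in> W" "W \<subseteq> \<Union>U" "holo_vec f W"
    "\<And>w. w \<in> W \<Longrightarrow> F (proj w) = proj (f w)"
    using chart[OF x0U] by blast
  have "herm_form Pos' Neg' (f z) (f w) = 0" if "z \<in> W" "w \<in> W" for z w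
  proof (rule local_orthogonal_isotropic[OF assms(1,3) W(1,2,5) _ W(3) _ that])
    show "herm_form Pos Neg x0 x0 = 0"
      using P0(2) mem_proj_self unfolding x0(1) null_point_def by blast
    fix z w assume zw: "z \<in> W" "w \<in> W" "herm_form Pos Neg z w = 0"
    then have "proj z \<in> U" "proj w \<in> U"
      using W(4) mem_Union_Pspace_iff[OF UP] by blast+
    then show "herm_form Pos' Neg' (f z) (f w) = 0"
      using orth[of "proj z" "proj w"] zw by (simp add: W(6) proj_orth_iff)
  qed
  \<comment> \<open>The span of the lift near one null point is null; it remains to see that
    \<open>F\<close> never leaves it.\<close>
  define H where "H = annihilator_hull (f ` W)"
  have H: "null_space Pos' Neg' H" "complex_subspace H"
    unfolding H_def using \<open>\<And>w z. z \<in> W \<Longrightarrow> w \<in> W \<Longrightarrow> herm_form Pos' Neg' (f z) (f w) = 0\<close>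
    by (auto intro: null_space_annihilator_hull complex_subspace_annihilator_hull)

  have "\<Union>U \<subseteq> {x \<in> \<Union>U. F (proj x) \<subseteq> H}" (is "_ \<subseteq> ?Q")
  proof (rule connectedin_proj_top_induct[OF U _ W(1,3) x0U])
    show "W \<subseteq> ?Q"
    proof
      fix w assume w: "w \<in> W"
      then have "f w \<in> H" unfolding H_def using subset_annihilator_hull by blast
      then have "F (proj w) \<subseteq> H" unfolding W(6)[OF w] proj_subset_iff[OF H(2)] .
      then show "w \<in> ?Q" using W(4) w by blast
    qed
    show "c *s x \<in> ?Q" if "x \<in> ?Q" "c \<noteq> 0" for x c
    proof -
      have "x \<noteq> 0" "proj x \<in> U" using that(1) mem_Union_Pspace_iff[OF UP, of x] by auto
      then show ?thesis
        using that by (simp add: mem_Union_Pspace_iff[OF UP] proj_smult del: Union_iff)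
    qed
    fix x assume x: "x \<in> \<Union>U"
    obtain V g where V: "open V" "convex V" "x \<in> V" "V \<subseteq> \<Union>U" "holo_vec g V"
      "\<And>w. w \<in> V \<Longrightarrow> F (proj w) = proj (g w)"
      using chart[OF x] by blast
    have Q: "w \<in> ?Q \<longleftrightarrow> g w \<in> H" if "w \<in> V" for w
      using V(4) that unfolding mem_Collect_eq V(6)[OF that] proj_subset_iff[OF H(2)] by blast
    have "V \<subseteq> ?Q" if X: "open X" "X \<subseteq> V \<inter> ?Q" "X \<noteq> {}" for X
    proof
      fix w assume w: "w \<in> V"
      obtain y where y: "y \<in> X" using X(3) by blast
      have XV: "X \<subseteq> V" using X(2) by blast
      have XH: "g v \<in> H" if "v \<in> X" for v using X(2) that Q[of v] by blast
      \<comment> \<open>A functional that vanishes on \<open>H\<close>, composed with the lift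
        \<open>g\<close>, is zero on the open set \<open>X\<close> and so on all of
        \<open>V\<close>.\<close>
      have "(\<Sum>j\<in>UNIV. c $ j * g w $ j) = 0"
        if "\<forall>u\<in>f ` W. (\<Sum>j\<in>UNIV. c $ j * u $ j) = 0" for c :: "complex^'m"
        by (rule holo_on_lines_zero_of_open[OF holo_vec_linear_combination[OF V(5)] V(1,2) X(1) y XV _ w])
           (use XH that in \<open>auto simp: H_def annihilator_hull_def\<close>)
      then have "g w \<in> H" by (auto simp: H_def annihilator_hull_def)
      then show "w \<in> ?Q" using Q[OF w] by blast
    qed
    with V show "\<exists>W. open W \<and> x \<in> W \<and> (\<forall>X. open X \<longrightarrow> X \<subseteq> W \<inter> ?Q \<longrightarrow> X \<noteq> {} \<longrightarrow> W \<subseteq> ?Q)"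
      by blast
  qed
  then have "F p \<subseteq> H" if p: "p \<in> U" for p
  proof -
    obtain x :: "complex^'n" where "p = proj x" using p UP unfolding Pspace_def by blast
    moreover from this have "x \<in> \<Union>U" using p mem_proj_self by blast
    ultimately show ?thesis using \<open>\<Union>U \<subseteq> ?Q\<close> by blast
  qed
  then show ?thesis
    using H(1) unfolding null_map_def by blast
qed

end
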